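(* Let $F=0$ be a structurally amenable DAE of size $n$ in the variables $x_1,\dots,x_n$, with valid offsets $(c,d)$. Let $m\ge1$, let $u$ be a scalar and $v=(v_1,\dots,v_m)$ an $m$-vector, where $u$ and the components $v_i$ of $v$ are aliases for some of the $x_j$. Suppose the first $m$ equations of $F=0$ are $$0=F_i(\underline{x})=v_i-g_i(u),\qquad i=1,\dots,m,$$ where $g=(g_1,\dots,g_m)$ is an $m$-vector function of the scalar $u$, and let $h=(h_1,\dots,h_m)$ be an $m$-vector function of $(u,v)$ with $g'(u)=h(u,g(u))$. Define the DAE $\overline{F}=0$ of size $n$ by $$\overline{F}_i(\underline{x})=\begin{cases}\dot v_i-h_i(u,v)\,\dot u, & i=1,\dots,m,\\ F_i(\underline{x}), & \text{otherwise.}\end{cases}$$ Then: (i) Every solution $x(t)$ of $F=0$ is a solution of $\overline{F}=0$; if $h$ is sufficiently smooth, the converse holds. (ii) Along such a solution, $F=0$ and $\overline{F}=0$ have the same system Jacobian, in the sense that $\mathbf{J}(\overline{F};(c^*,d^* ))=\mathbf{J}(F;(c,d))$, where $(c^*,d^* )=\mathfrak{d}^{(k)}(c,d)$ and the multi-index $k=(1,\dots,1,0,\dots,0)$ has its first $m$ entries equal to $1$ and the rest $0$. Hence $\overline{F}=0$ is structurally amenable.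
   Context: A DAE of size $n$ is a system $F_i(t,\text{the }x_j\text{ and derivatives of them})=0$, $i=1,\dots,n$, in unknown functions $x_j=x_j(t)$, $j=1,\dots,n$; it is written $F=0$ or $F(\underline{x})=0$, where $\underline{x}$ denotes the vector of $t$ and all derivatives $x_j^{(k)}$, $k\ge0$, that occur in the $F_i$. A dot means $d/dt$. Functions are assumed suitably smooth so that needed derivatives exist. Built-in initial value convention: replacing $v=g(u)$ by the sub-ODE $\dot v=h(u,v)\,\dot u$ is always accompanied by the built-in initial value $v(t_0)=g(u(t_0))$ at the given base point $t_0$, so solutions of $\overline{F}=0$ are understood to be those satisfying it. Signature matrix: $\Sigma=(\sigma_{ij})$ is the $n\times n$ matrix with $\sigma_{ij}$ the highest order of derivative of $x_j$ occurring in $F_i$ (the 0th derivative being $x_j$ itself), or $-\infty$ if $x_j$ does not occur in $F_i$. A transversal is a set of $n$ positions $(i,j)$ with exactly one in each row and each column. Offsets: a pair of integer vectors $c=(c_1,\dots,c_n)$, $d=(d_1,\dots,d_n)$. They are valid if $d_j-c_i\ge\sigma_{ij}$ for all $i,j$, with equality for all $(i,j)$ on some transversal. System Jacobian: $\mathbf{J}(F;(c,d))$ is the $n\times n$ matrix with $(i,j)$ entry $\partial F_i/\partial x_j^{(\sigma_{ij})}$ if $d_j-c_i=\sigma_{ij}$, and $0$ otherwise. The DAE is structurally amenable if there are valid offsets for which the system Jacobian is nonsingular somewhere, i.e. at some point lying on a solution path. For a multi-index $k=(k_1,\dots,k_n)$ of nonnegative integers, $\mathfrak{d}^{(k)}(c,d)$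 is the offset pair obtained by first replacing $c$ by $c-k$, then forming $\gamma=\min_i c_i$ and replacing each $c_i$ by $c_i-\gamma$ and each $d_j$ by $d_j-\gamma$.
   Formalization: The Jacobian identity and validity of (c*,d* ) assume c_i ≤ d_j whenever x_j = v_k, k≠i, occurs in h_i(u,v)u'; validity and amenability of F̄ assume u occurs in F_i if it occurs in F̄_i (i≤m), excluding constant g_i with h_i not identically 0. Part (ii) fails without these. *)

theory Defs
  imports "HOL-Analysis.Analysis" "Jordan_Normal_Form.Determinant"
begin

text \<open>
  Equations, variables and offsets are indexed from 0, by the natural numbers below the size
  \<open>n\<close>.  In a point \<open>(t, X)\<close> the number \<open>X j k\<close> stands for the value of the \<open>k\<close>-th derivative of
  \<open>x\<^sub>j\<close>.  The equations are total functions \<open>F i t X\<close>, but only their values on a domain \<open>D\<close> matter;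
  this admits functions such as logarithms and quotients.  The number \<open>p j\<close> is the order up to
  which \<open>x\<^sub>j\<close> is supposed to be continuously differentiable; it bounds the orders that occur.
\<close>

type_synonym jet = "nat \<Rightarrow> nat \<Rightarrow> real"
type_synonym eqns = "nat \<Rightarrow> real \<Rightarrow> jet \<Rightarrow> real"

text \<open>Openness of \<open>D\<close> refers to the product topology, so membership is locally a condition on
  finitely many coordinates.\<close>

definition is_dae :: "nat \<Rightarrow> (nat \<Rightarrow> nat) \<Rightarrow> (real \<times> jet) set \<Rightarrow> eqns \<Rightarrow> bool" where
  "is_dae n p D F \<longleftrightarrow> open D \<and>
     (\<forall>i<n. \<forall>t X Y. (t, X) \<in> D \<longrightarrow> (t, Y) \<in> D \<longrightarrow>
        (\<forall>j<n. \<forall>k\<le>p j. X j k = Y j k) \<longrightarrow> F i t X = F i t Y)"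

definition upd :: "jet \<Rightarrow> nat \<Rightarrow> nat \<Rightarrow> real \<Rightarrow> jet" where
  "upd X j k s = X(j := (X j)(k := s))"

definition partial :: "(real \<Rightarrow> jet \<Rightarrow> real) \<Rightarrow> nat \<Rightarrow> nat \<Rightarrow> real \<Rightarrow> jet \<Rightarrow> real" where
  "partial f j k t X = deriv (\<lambda>s. f t (upd X j k s)) (X j k)"

definition occurs :: "(real \<times> jet) set \<Rightarrow> (real \<Rightarrow> jet \<Rightarrow> real) \<Rightarrow> nat \<Rightarrow> nat \<Rightarrow> bool" where
  "occurs D f j k \<longleftrightarrow>
     (\<exists>t X s. (t, X) \<in> D \<and> (t, upd X j k s) \<in> D \<and> f t X \<noteq> f t (upd X j k s))"

definition sigma :: "(real \<times> jet) set \<Rightarrow> eqns \<Rightarrow> nat \<Rightarrow> nat \<Rightarrow> ereal" where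
  "sigma D F i j =
     (if \<exists>k. occurs D (F i) j k then ereal (real (Max {k. occurs D (F i) j k})) else -\<infinity>)"

definition transversal :: "nat \<Rightarrow> (nat \<times> nat) set \<Rightarrow> bool" where
  "transversal n T \<longleftrightarrow> T \<subseteq> {..<n} \<times> {..<n} \<and>
     (\<forall>i<n. \<exists>!j. (i, j) \<in> T) \<and> (\<forall>j<n. \<exists>!i. (i, j) \<in> T)"

definition valid_offsets ::
  "nat \<Rightarrow> (real \<times> jet) set \<Rightarrow> eqns \<Rightarrow> (nat \<Rightarrow> int) \<times> (nat \<Rightarrow> int) \<Rightarrow> bool" where
  "valid_offsets n D F = (\<lambda>(c, d).
     (\<forall>i<n. \<forall>j<n. sigma D F i j \<le> ereal (of_int (d j - c i))) \<and>
     (\<exists>T. transversal n T \<and> (\<forall>(i, j)\<in>T. ereal (of_int (d j - c i)) = sigma D F i j)))"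

definition jacobian ::
  "nat \<Rightarrow> (real \<times> jet) set \<Rightarrow> eqns \<Rightarrow> (nat \<Rightarrow> int) \<times> (nat \<Rightarrow> int) \<Rightarrow> real \<Rightarrow> jet \<Rightarrow> real mat" where
  "jacobian n D F = (\<lambda>(c, d) t X. mat n n (\<lambda>(i, j).
     if ereal (of_int (d j - c i)) = sigma D F i j
     then partial (F i) j (nat (d j - c i)) t X else 0))"

definition shift_offsets ::
  "nat \<Rightarrow> (nat \<Rightarrow> nat) \<Rightarrow> (nat \<Rightarrow> int) \<times> (nat \<Rightarrow> int) \<Rightarrow> (nat \<Rightarrow> int) \<times> (nat \<Rightarrow> int)" where
  "shift_offsets n k = (\<lambda>(c, d).
     let c' = (\<lambda>i. c i - int (k i)); \<gamma> = Min (c' ` {..<n})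
     in (\<lambda>i. c' i - \<gamma>, \<lambda>j. d j - \<gamma>))"

definition C_times :: "nat \<Rightarrow> real set \<Rightarrow> (real \<Rightarrow> real) \<Rightarrow> bool" where
  "C_times r I f \<longleftrightarrow>
     (\<forall>k<r. \<forall>t\<in>I. (deriv ^^ k) f field_differentiable at t) \<and> continuous_on I ((deriv ^^ r) f)"

definition jet_of :: "nat \<Rightarrow> (nat \<Rightarrow> nat) \<Rightarrow> (nat \<Rightarrow> real \<Rightarrow> real) \<Rightarrow> real \<Rightarrow> jet" where
  "jet_of n p x t = (\<lambda>j k. if j < n \<and> k \<le> p j then (deriv ^^ k) (x j) t else 0)"

text \<open>A solution is a pair of an open interval \<open>I\<close> around the base point \<open>t0\<close> and functions
  \<open>x j\<close>, whose values outside \<open>I\<close> are irrelevant.\<close>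

type_synonym path = "real set \<times> (nat \<Rightarrow> real \<Rightarrow> real)"

definition solutions ::
  "nat \<Rightarrow> (nat \<Rightarrow> nat) \<Rightarrow> (real \<times> jet) set \<Rightarrow> real \<Rightarrow> eqns \<Rightarrow> path set" where
  "solutions n p D t0 F = {(I, x).
     open I \<and> is_interval I \<and> t0 \<in> I \<and> (\<forall>j<n. C_times (p j) I (x j)) \<and>
     (\<forall>t\<in>I. (t, jet_of n p x t) \<in> D \<and> (\<forall>i<n. F i t (jet_of n p x t) = 0))}"

text \<open>The set \<open>S\<close> of solution paths is a parameter because the solutions of a DAE containing a
  sub-ODE are restricted by the built-in initial values.\<close>

definition structurally_amenable ::
  "nat \<Rightarrow> (nat \<Rightarrow> nat) \<Rightarrow> (real \<times> jet) set \<Rightarrow> eqns \<Rightarrow> path set \<Rightarrow> bool" where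
  "structurally_amenable n p D F S \<longleftrightarrow>
     (\<exists>cd. valid_offsets n D F cd \<and>
        (\<exists>(I, x)\<in>S. \<exists>t\<in>I. Determinant.det (jacobian n D F cd t (jet_of n p x t)) \<noteq> 0))"

text \<open>An \<open>m\<close>-vector is a function on the natural numbers that vanishes from \<open>m\<close> on.\<close>

definition vec_of :: "nat \<Rightarrow> (nat \<Rightarrow> real) \<Rightarrow> nat \<Rightarrow> real" where
  "vec_of m y = (\<lambda>k. if k < m then y k else 0)"

text \<open>The scalar \<open>u\<close> is an alias of variable number \<open>u\<close>, the component \<open>v\<^sub>k\<close> of variable number
  \<open>v k\<close>.\<close>

definition sub_ode ::
  "nat \<Rightarrow> nat \<Rightarrow> (nat \<Rightarrow> nat) \<Rightarrow> (nat \<Rightarrow> real \<Rightarrow> (nat \<Rightarrow> real) \<Rightarrow> real) \<Rightarrow> eqns \<Rightarrow> eqns" where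
  "sub_ode m u v h F = (\<lambda>i t X.
     if i < m then X (v i) 1 - h i (X u 0) (vec_of m (\<lambda>k. X (v k) 0)) * X u 1
     else F i t X)"

definition sub_ode_solutions ::
  "nat \<Rightarrow> (nat \<Rightarrow> nat) \<Rightarrow> (real \<times> jet) set \<Rightarrow> real \<Rightarrow> nat \<Rightarrow> nat \<Rightarrow> (nat \<Rightarrow> nat) \<Rightarrow>
   (nat \<Rightarrow> real \<Rightarrow> real) \<Rightarrow> (nat \<Rightarrow> real \<Rightarrow> (nat \<Rightarrow> real) \<Rightarrow> real) \<Rightarrow> eqns \<Rightarrow> path set" where
  "sub_ode_solutions n p D t0 m u v g h F =
     {(I, x) \<in> solutions n p D t0 (sub_ode m u v h F). \<forall>i<m. x (v i) t0 = g i (x u t0)}"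

text \<open>The smoothness of \<open>h\<close> needed for the converse: local Lipschitz continuity in the vector
  argument, uniformly in the scalar one.  It holds if \<open>h\<close> is continuously differentiable on an
  open set.\<close>

definition loc_lipschitz ::
  "nat \<Rightarrow> (real \<times> (nat \<Rightarrow> real)) set \<Rightarrow> (nat \<Rightarrow> real \<Rightarrow> (nat \<Rightarrow> real) \<Rightarrow> real) \<Rightarrow> bool" where
  "loc_lipschitz m E h \<longleftrightarrow> (\<forall>q\<in>E. \<exists>N L. open N \<and> q \<in> N \<and>
     (\<forall>b y z. (b, y) \<in> N \<inter> E \<longrightarrow> (b, z) \<in> N \<inter> E \<longrightarrow>
        (\<forall>i<m. \<bar>h i b y - h i b z\<bar> \<le> L * (\<Sum>k<m. \<bar>y k - z k\<bar>))))"

text \<open>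
  Two side conditions on the variables occurring in the new equations.

  If \<open>g i\<close> is constant, \<open>h i\<close> vanishes on the graph of \<open>g\<close> but possibly not elsewhere, and then
  \<open>u\<close> occurs in the new equation only; the first condition excludes this.  It holds whenever \<open>u\<close>
  occurs in all the equations \<open>v\<^sub>i - g\<^sub>i(u)\<close>.

  The second one concerns components \<open>v\<^sub>k\<close>, \<open>k \<noteq> i\<close>, which occur in \<open>h\<^sub>i(u,v)\<close> but not in
  \<open>v\<^sub>i - g\<^sub>i(u)\<close>.  Validity of the offsets implies \<open>d (v k) \<ge> c k\<close>, but no relation between
  \<open>d (v k)\<close> and \<open>c i\<close>.  The Jacobians do differ for \<open>v\<^sub>0 = sin u\<close>, \<open>v\<^sub>1 = cos u\<close>,
  \<open>h = (v\<^sub>1, - v\<^sub>0)\<close> together with \<open>v\<^sub>0'''' = q(t)\<close>, \<open>w = u'\<close>, where \<open>c = (1,0,0,0)\<close> and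
  \<open>d = (4,0,1,0)\<close> for the variables \<open>v\<^sub>0, v\<^sub>1, u, w\<close>: the first equation acquires the entry \<open>- u'\<close>
  in the column of \<open>v\<^sub>1\<close>.  The condition is void for \<open>m = 1\<close>, and holds for valid offsets with
  \<open>c\<^sub>0 = \<dots> = c\<^sub>m\<^sub>-\<^sub>1\<close>.
\<close>

definition no_spurious_u :: "nat \<Rightarrow> nat \<Rightarrow> (real \<times> jet) set \<Rightarrow> eqns \<Rightarrow> eqns \<Rightarrow> bool" where
  "no_spurious_u m u D F Fbar \<longleftrightarrow>
     (\<forall>i<m. sigma D Fbar i u \<noteq> -\<infinity> \<longrightarrow> sigma D F i u \<noteq> -\<infinity>)"

definition cross_terms_covered ::
  "nat \<Rightarrow> (nat \<Rightarrow> nat) \<Rightarrow> (real \<times> jet) set \<Rightarrow> eqns \<Rightarrow> (nat \<Rightarrow> int) \<times> (nat \<Rightarrow> int) \<Rightarrow> bool" where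
  "cross_terms_covered m v D Fbar = (\<lambda>(c, d).
     \<forall>i<m. \<forall>k<m. i \<noteq> k \<longrightarrow> sigma D Fbar i (v k) \<noteq> -\<infinity> \<longrightarrow> c i \<le> d (v k))"

end

theory Submission
  imports Defs
begin

text \<open>
  The algebraic equations imply the sub-ODE by the chain rule.  Conversely the defects
  \<open>z\<^sub>k = v\<^sub>k - g\<^sub>k(u)\<close> vanish at \<open>t\<^sub>0\<close> and satisfy a linear differential inequality locally, so they
  vanish on an open and closed subset of the interval.  On the graph of \<open>g\<close> the Jacobians agree entry
  by entry, as both orders and offset differences of the first \<open>m\<close> rows go up by one.

  Structural amenability needs offsets whose cross terms are covered.  The given ones may fail
  this, but they can be raised to offsets that do not; and since the determinant of the system
  Jacobian does not depend on the choice of valid offsets, nonsingularity is preserved.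
\<close>

section \<open>Uniqueness for linear differential inequalities\<close>

text \<open>Gronwall with an integrating factor: \<open>w s * exp (- K * s)\<close> has nonpositive
  derivative and starts at 0, so \<open>w b\<close> cannot be positive.\<close>

lemma nonneg_growth_zero_right:
  fixes w w' :: "real \<Rightarrow> real"
  assumes w: "\<And>s. a \<le> s \<Longrightarrow> s \<le> b \<Longrightarrow> (w has_real_derivative w' s) (at s)"
    and w': "\<And>s. a \<le> s \<Longrightarrow> s \<le> b \<Longrightarrow> w' s \<le> K * w s"
    and "a \<le> b" "w a = 0" "0 \<le> w b"
  shows "w b = 0"
proof -
  have "w b * exp (- K * b) \<le> w a * exp (- K * a)"
  proof (rule DERIV_nonpos_imp_nonincreasing [OF \<open>a \<le> b\<close>])
    fix s assume s: "a \<le> s" "s \<le> b"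
    have "((\<lambda>s. w s * exp (- K * s)) has_real_derivative (w' s - K * w s) * exp (- K * s)) (at s)"
      by (rule derivative_eq_intros w s refl)+ (simp add: algebra_simps)
    moreover have "(w' s - K * w s) * exp (- K * s) \<le> 0"
      using w'[OF s] by (intro mult_nonpos_nonneg) auto
    ultimately show "\<exists>y. ((\<lambda>s. w s * exp (- K * s)) has_real_derivative y) (at s) \<and> y \<le> 0"
      by blast
  qed
  then show ?thesis
    using assms(4,5) by (simp add: mult_le_0_iff)
qed

text \<open>Points to the left of \<open>a\<close> are reached by reflecting time; the two-sided
  bound on \<open>w'\<close> survives the reflection.\<close>

lemma nonneg_growth_zero:
  fixes w w' :: "real \<Rightarrow> real"
  assumes w: "\<And>s. s \<in> J \<Longrightarrow> (w has_real_derivative w' s) (at s)"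
    and w': "\<And>s. s \<in> J \<Longrightarrow> \<bar>w' s\<bar> \<le> K * w s"
    and J: "is_interval J" "a \<in> J" "b \<in> J" and "w a = 0" "0 \<le> w b"
  shows "w b = 0"
proof (cases "a \<le> b")
  case True
  have "s \<in> J" if "a \<le> s" "s \<le> b" for s
    using J that by (meson mem_is_interval_1_I)
  then show ?thesis
    using assms True abs_le_D1 by (intro nonneg_growth_zero_right [of a b w w' K]) blast+
next
  case False
  have in_J: "- s \<in> J" if "- a \<le> s" "s \<le> - b" for s
    using J that by (meson mem_is_interval_1_I minus_le_iff le_minus_iff)
  have "w (- (- b)) = 0"
  proof (rule nonneg_growth_zero_right [of "- a" "- b" "\<lambda>s. w (- s)" "\<lambda>s. - w' (- s)" K])
    fix s assume s: "- a \<le> s" "s \<le> - b"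
    show "((\<lambda>s. w (- s)) has_real_derivative - w' (- s)) (at s)"
      using w[OF in_J[OF s]] by (simp add: DERIV_mirror)
    show "- w' (- s) \<le> K * w (- s)"
      using w'[OF in_J[OF s]] by simp
  qed (use False assms in auto)
  then show ?thesis by simp
qed

text \<open>Gronwall is applied to the sum of squares, which unlike the sum of absolute values is
  differentiable. The rate \<open>2 * K * m\<close> comes from Cauchy-Schwarz: the squared sum of
  the absolute values is at most \<open>m\<close> times the sum of squares.\<close>

lemma linear_growth_zero:
  fixes z z' :: "nat \<Rightarrow> real \<Rightarrow> real"
  assumes z: "\<And>i s. i < m \<Longrightarrow> s \<in> J \<Longrightarrow> (z i has_real_derivative z' i s) (at s)"
    and z': "\<And>i s. i < m \<Longrightarrow> s \<in> J \<Longrightarrow> \<bar>z' i s\<bar> \<le> K * (\<Sum>k<m. \<bar>z k s\<bar>)"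
    and K: "0 \<le> K"
    and J: "is_interval J" "a \<in> J" "b \<in> J"
    and a: "\<And>i. i < m \<Longrightarrow> z i a = 0"
    and "i < m"
  shows "z i b = 0"
proof -
  define w where "w s = (\<Sum>i<m. (z i s)\<^sup>2)" for s
  define w' where "w' s = (\<Sum>i<m. 2 * z i s * z' i s)" for s
  have "w b = 0"
  proof (rule nonneg_growth_zero [of J w w' "2 * K * m"])
    fix s assume s: "s \<in> J"
    show "(w has_real_derivative w' s) (at s)"
      unfolding w_def w'_def by (rule derivative_eq_intros z s refl | simp add: mult_ac)+
    let ?S = "\<Sum>k<m. \<bar>z k s\<bar>"
    have "\<bar>w' s\<bar> \<le> (\<Sum>i<m. \<bar>2 * z i s * z' i s\<bar>)"
      unfolding w'_def by (rule sum_abs)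
    also have "\<dots> \<le> (\<Sum>i<m. 2 * \<bar>z i s\<bar> * (K * ?S))"
    proof (intro sum_mono)
      fix i assume "i \<in> {..<m}"
      then show "\<bar>2 * z i s * z' i s\<bar> \<le> 2 * \<bar>z i s\<bar> * (K * ?S)"
        using z'[of i s] s by (simp add: abs_mult mult_left_mono)
    qed
    also have "\<dots> = 2 * K * ?S\<^sup>2"
      by (simp add: power2_eq_square sum_distrib_right sum_distrib_left mult_ac)
    also have "\<dots> \<le> 2 * K * (w s * m)"
      using sum_squared_le_sum_of_squares [of "\<lambda>k. \<bar>z k s\<bar>" "{..<m}"] K
      by (intro mult_left_mono) (auto simp: w_def)
    finally show "\<bar>w' s\<bar> \<le> 2 * K * m * w s"
      by (simp add: mult_ac)
  qed (use J a in \<open>auto simp: w_def sum_nonneg\<close>)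
  then show ?thesis
    using \<open>i < m\<close> by (simp add: w_def sum_nonneg_eq_0_iff)
qed

section \<open>Jets and partial derivatives\<close>

lemma upd_same [simp]: "upd X j k (X j k) = X"
  by (simp add: upd_def)

lemma upd_apply: "upd X j k s j' k' = (if j' = j \<and> k' = k then s else X j' k')"
  by (simp add: upd_def)

text \<open>In the product topology a jet depends continuously on each single coordinate, so the
  admissible values of that coordinate form an open set.\<close>

lemma eventually_upd_in_open:
  assumes "open D" "(t, X) \<in> D"
  shows "\<forall>\<^sub>F s in nhds (X j k). (t, upd X j k s) \<in> D"
proof -
  have "continuous_on UNIV (\<lambda>s. upd X j k s)"
  proof (intro continuous_on_coordinatewise_then_product)
    fix j' k'
    show "continuous_on UNIV (\<lambda>s. upd X j k s j' k')"
      by (cases "j' = j \<and> k' = k") (auto simp: upd_apply)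
  qed
  then have "continuous_on UNIV (\<lambda>s. (t, upd X j k s))"
    by (intro continuous_on_Pair continuous_on_const)
  then have "open ((\<lambda>s. (t, upd X j k s)) -` D)"
    using \<open>open D\<close> by (simp add: open_vimage)
  from eventually_nhds_in_open [OF this, of "X j k"] show ?thesis
    using assms(2) by simp
qed

text \<open>Supplies witnesses for \<open>occurs\<close>, which asks for both jets to lie in
  \<open>D\<close>. A punctured neighbourhood of a real number is never empty.\<close>

lemma upd_neq_in_open:
  assumes "open D" "(t, X) \<in> D"
  obtains s where "s \<noteq> X j k" "(t, upd X j k s) \<in> D"
proof -
  have "\<forall>\<^sub>F s in at (X j k). s \<noteq> X j k \<and> (t, upd X j k s) \<in> D"
    using eventually_upd_in_open [OF assms] unfolding eventually_at_filter
    by (rule eventually_mono) auto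
  then show ?thesis
    using eventually_happens [of _ "at (X j k)"] that by (auto simp: trivial_limit_at)
qed

text \<open>A derivative depends only on the germ of the function, so a formula for \<open>f\<close>
  valid on the open set \<open>D\<close> determines it.\<close>

lemma partial_eqI:
  assumes D: "open D" "(t, X) \<in> D"
    and f: "\<And>s. (t, upd X j k s) \<in> D \<Longrightarrow> f t (upd X j k s) = e s"
    and e: "(e has_real_derivative e') (at (X j k))"
  shows "partial f j k t X = e'"
proof -
  have "\<forall>\<^sub>F s in nhds (X j k). f t (upd X j k s) = e s"
    using eventually_upd_in_open [OF D] by (rule eventually_mono) (rule f)
  then have "partial f j k t X = deriv e (X j k)"
    unfolding partial_def by (rule deriv_cong_ev) simp
  with e show ?thesis by (simp add: DERIV_imp_deriv)
qed

lemma partial_eq_0: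
  assumes "open D" "(t, X) \<in> D" "\<not> occurs D f j k"
  shows "partial f j k t X = 0"
  using assms by (intro partial_eqI [of D _ _ _ _ _ "\<lambda>_. f t X"]) (auto simp: occurs_def)

section \<open>Highest occurring orders\<close>

lemma sigma_eq_minf: "(\<And>k. \<not> occurs D (F i) j k) \<Longrightarrow> sigma D F i j = -\<infinity>"
  by (simp add: sigma_def)

text \<open>The upper bound also makes the set of occurring orders finite, so that
  \<open>Max\<close> is meaningful.\<close>

lemma sigma_eq:
  assumes "occurs D (F i) j k" "\<And>l. occurs D (F i) j l \<Longrightarrow> l \<le> k"
  shows "sigma D F i j = ereal (real k)"
proof -
  have "Max {l. occurs D (F i) j l} = k"
    using assms by (intro Max_eqI) (auto intro: finite_subset [of _ "{..k}"])
  with assms(1) show ?thesis by (auto simp: sigma_def)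
qed

section \<open>Offsets and the determinant of the system Jacobian\<close>

text \<open>Transversals are handled as permutations \<open>q\<close>, row \<open>i\<close> being
  matched to column \<open>q i\<close>, to fit the Leibniz expansion of the determinant.\<close>

definition tight ::
  "nat \<Rightarrow> (real \<times> jet) set \<Rightarrow> eqns \<Rightarrow> (nat \<Rightarrow> int) \<times> (nat \<Rightarrow> int) \<Rightarrow> (nat \<Rightarrow> nat) \<Rightarrow> bool" where
  "tight n D F = (\<lambda>(c, d) q. \<forall>i<n. ereal (of_int (d (q i) - c i)) = sigma D F i (q i))"

lemma transversal_of_permutation:
  assumes "q permutes {..<n}"
  shows "transversal n ((\<lambda>i. (i, q i)) ` {..<n})"
proof -
  have "\<exists>!i. (i, j) \<in> (\<lambda>i. (i, q i)) ` {..<n}" if "j < n" for j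
  proof (rule ex1I [of _ "inv_into UNIV q j"])
    show "(inv_into UNIV q j, j) \<in> (\<lambda>i. (i, q i)) ` {..<n}"
      using permutes_in_image [OF permutes_inv [OF assms], of j] that permutes_inverses [OF assms]
      by (intro image_eqI [of _ _ "inv_into UNIV q j"]) auto
  qed (use permutes_inverses [OF assms] in auto)
  moreover have "q i < n" if "i < n" for i
    using permutes_in_image [OF assms, of i] that by simp
  ultimately show ?thesis
    by (auto simp: transversal_def)
qed

text \<open>Uniqueness within columns makes \<open>q\<close> injective, hence surjective on the
  finite index set; \<open>permutes\<close> demands the identity outside it.\<close>

lemma permutation_of_transversal:
  assumes "transversal n T"
  obtains q where "q permutes {..<n}" "\<And>i. i < n \<Longrightarrow> (i, q i) \<in> T"
proof -
  define q where "q i = (if i < n then THE j. (i, j) \<in> T else i)" for i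
  have T: "T \<subseteq> {..<n} \<times> {..<n}" "\<forall>i<n. \<exists>!j. (i, j) \<in> T" "\<forall>j<n. \<exists>!i. (i, j) \<in> T"
    using assms by (auto simp: transversal_def)
  have q: "(i, q i) \<in> T" if "i < n" for i
    using theI' [of "\<lambda>j. (i, j) \<in> T"] T(2) that by (auto simp: q_def)
  have inj: "inj_on q {..<n}"
  proof (rule inj_onI)
    fix i i' assume "i \<in> {..<n}" "i' \<in> {..<n}" "q i = q i'"
    then show "i = i'"
      using q[of i] q[of i'] T(1,3) by auto
  qed
  have "q permutes {..<n}"
  proof (rule bij_imp_permutes)
    show "bij_betw q {..<n} {..<n}"
      unfolding bij_betw_def using inj q T(1) by (intro conjI endo_inj_surj) auto
  qed (simp add: q_def)
  then show ?thesis using that q by blast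
qed

lemma valid_offsets_iff:
  "valid_offsets n D F (c, d) \<longleftrightarrow>
     (\<forall>i<n. \<forall>j<n. sigma D F i j \<le> ereal (of_int (d j - c i))) \<and>
     (\<exists>q. q permutes {..<n} \<and> tight n D F (c, d) q)"
proof -
  have "(\<exists>T. transversal n T \<and> (\<forall>(i, j)\<in>T. ereal (of_int (d j - c i)) = sigma D F i j)) \<longleftrightarrow>
        (\<exists>q. q permutes {..<n} \<and> tight n D F (c, d) q)"
  proof
    assume "\<exists>T. transversal n T \<and> (\<forall>(i, j)\<in>T. ereal (of_int (d j - c i)) = sigma D F i j)"
    then obtain T where T: "transversal n T"
      "\<forall>(i, j)\<in>T. ereal (of_int (d j - c i)) = sigma D F i j" by blast
    obtain q where "q permutes {..<n}" "\<And>i. i < n \<Longrightarrow> (i, q i) \<in> T"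
      using permutation_of_transversal [OF T(1)] by blast
    with T(2) show "\<exists>q. q permutes {..<n} \<and> tight n D F (c, d) q"
      by (fastforce simp: tight_def)
  next
    assume "\<exists>q. q permutes {..<n} \<and> tight n D F (c, d) q"
    then obtain q where q: "q permutes {..<n}" "tight n D F (c, d) q" by blast
    show "\<exists>T. transversal n T \<and> (\<forall>(i, j)\<in>T. ereal (of_int (d j - c i)) = sigma D F i j)"
      using transversal_of_permutation [OF q(1)] q(2)
      by (intro exI [of _ "(\<lambda>i. (i, q i)) ` {..<n}"]) (auto simp: tight_def)
  qed
  then show ?thesis
    by (simp add: valid_offsets_def)
qed

text \<open>Weak duality: along \<open>q\<close> the second offsets attain the orders, which the
  first ones bound from above. Summed over a permutation, \<open>d (q i) - c i\<close> gives a value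
  independent of the permutation.\<close>

lemma tight_offset_sum_le:
  assumes "valid_offsets n D F (c1, d1)" "q permutes {..<n}" "tight n D F (c2, d2) q"
  shows "(\<Sum>i<n. d2 i) - (\<Sum>i<n. c2 i) \<le> (\<Sum>i<n. d1 i) - (\<Sum>i<n. c1 i)"
    and "i < n \<Longrightarrow> d2 (q i) - c2 i \<le> d1 (q i) - c1 i"
proof -
  have q: "q i < n" if "i < n" for i
    using permutes_in_image [OF assms(2), of i] that by simp
  show le: "d2 (q i) - c2 i \<le> d1 (q i) - c1 i" if "i < n" for i
  proof -
    have "ereal (of_int (d2 (q i) - c2 i)) \<le> ereal (of_int (d1 (q i) - c1 i))"
      using assms(1,3) that q[OF that] by (auto simp: tight_def valid_offsets_iff simp del: of_int_diff)
    then show ?thesis by simp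
  qed
  have "(\<Sum>i<n. d2 (q i) - c2 i) \<le> (\<Sum>i<n. d1 (q i) - c1 i)"
    by (intro sum_mono le) simp
  then show "(\<Sum>i<n. d2 i) - (\<Sum>i<n. c2 i) \<le> (\<Sum>i<n. d1 i) - (\<Sum>i<n. c1 i)"
    using sum.permute [OF assms(2), of d1] sum.permute [OF assms(2), of d2]
    by (simp add: sum_subtractf comp_def)
qed

text \<open>Linear programming duality: the offsets are dual variables, and a transversal is tight for
  one dual optimum iff it is tight for all of them.\<close>

lemma tight_offset_diff_eq:
  assumes V: "valid_offsets n D F (c1, d1)" "valid_offsets n D F (c2, d2)"
    and q: "q permutes {..<n}" "tight n D F (c2, d2) q" and "i < n"
  shows "d1 (q i) - c1 i = d2 (q i) - c2 i"
proof -
  obtain r where r: "r permutes {..<n}" "tight n D F (c1, d1) r"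
    using V(1) by (auto simp: valid_offsets_iff)
  have "(\<Sum>i<n. d2 i) - (\<Sum>i<n. c2 i) = (\<Sum>i<n. d1 i) - (\<Sum>i<n. c1 i)"
    using tight_offset_sum_le(1) [OF V(1) q] tight_offset_sum_le(1) [OF V(2) r] by simp
  then have "(\<Sum>i<n. d2 (q i) - c2 i) = (\<Sum>i<n. d1 (q i) - c1 i)"
    using sum.permute [OF q(1), of d1] sum.permute [OF q(1), of d2]
    by (simp add: sum_subtractf comp_def)
  \<comment> \<open>Termwise inequalities between families with equal sums are equalities.\<close>
  then show ?thesis
    using sum_mono_inv [of "\<lambda>i. d2 (q i) - c2 i" "{..<n}" "\<lambda>i. d1 (q i) - c1 i" i]
      tight_offset_sum_le(2) [OF V(1) q] \<open>i < n\<close> by simp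
qed

lemma tight_cong_offsets:
  assumes "valid_offsets n D F (c1, d1)" "valid_offsets n D F (c2, d2)" "q permutes {..<n}"
  shows "tight n D F (c1, d1) q \<longleftrightarrow> tight n D F (c2, d2) q"
  using tight_offset_diff_eq [OF assms] tight_offset_diff_eq [OF assms(2,1,3)]
  by (auto simp: tight_def simp del: of_int_diff)

section \<open>Leibniz expansion of the system Jacobian\<close>

lemma jacobian_index:
  assumes "i < n" "j < n"
  shows "jacobian n D F (c, d) t X $$ (i, j) =
    (if ereal (of_int (d j - c i)) = sigma D F i j then partial (F i) j (nat (d j - c i)) t X else 0)"
  using assms by (simp add: jacobian_def)

text \<open>A permutation that is not tight meets a position where the Jacobian is zero by
  definition.\<close>

lemma jacobian_prod_eq_0:
  assumes "q permutes {..<n}" "\<not> tight n D F (c, d) q"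
  shows "(\<Prod>i<n. jacobian n D F (c, d) t X $$ (i, q i)) = 0"
proof -
  obtain i where i: "i < n" "ereal (of_int (d (q i) - c i)) \<noteq> sigma D F i (q i)"
    using assms(2) by (auto simp: tight_def)
  then have "jacobian n D F (c, d) t X $$ (i, q i) = 0"
    using permutes_in_image [OF assms(1), of i] by (simp add: jacobian_index)
  then show ?thesis
    using \<open>i < n\<close> by (auto intro!: prod_zero)
qed

lemma det_jacobian:
  "Determinant.det (jacobian n D F cd t X) =
   (\<Sum>q | q permutes {..<n}. signof q * (\<Prod>i<n. jacobian n D F cd t X $$ (i, q i)))"
  by (cases cd) (simp add: Determinant.det_def jacobian_def atLeast0LessThan)

text \<open>The two matrices may differ, but only tight permutations contribute to the determinant;
  these are the same for both offsets, and along them the offset differences and hence the entries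
  agree.\<close>

lemma det_jacobian_cong_offsets:
  assumes V: "valid_offsets n D F (c1, d1)" "valid_offsets n D F (c2, d2)"
  shows "Determinant.det (jacobian n D F (c1, d1) t X) = Determinant.det (jacobian n D F (c2, d2) t X)"
  unfolding det_jacobian
proof (intro sum.cong refl arg_cong2 [where f = "(*)"])
  fix q assume "q \<in> {q. q permutes {..<n}}"
  then have q: "q permutes {..<n}" by simp
  show "(\<Prod>i<n. jacobian n D F (c1, d1) t X $$ (i, q i)) =
        (\<Prod>i<n. jacobian n D F (c2, d2) t X $$ (i, q i))"
  proof (cases "tight n D F (c2, d2) q")
    case True
    show ?thesis
    proof (intro prod.cong refl)
      fix i assume "i \<in> {..<n}"
      then have "i < n" "q i < n"
        using permutes_in_image [OF q, of i] by auto
      then show "jacobian n D F (c1, d1) t X $$ (i, q i) = jacobian n D F (c2, d2) t X $$ (i, q i)"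
        using tight_offset_diff_eq [OF V q True] by (simp only: jacobian_index)
    qed
  next
    case False
    then have "\<not> tight n D F (c1, d1) q"
      using tight_cong_offsets [OF V q] by simp
    with False show ?thesis
      by (simp only: jacobian_prod_eq_0 [OF q] not_False_eq_True)
  qed
qed

text \<open>At least one term of the Leibniz expansion is nonzero.\<close>

lemma nonzero_jacobian_transversal:
  assumes "Determinant.det (jacobian n D F (c, d) t X) \<noteq> 0"
  obtains q where "q permutes {..<n}" "\<And>i. i < n \<Longrightarrow> jacobian n D F (c, d) t X $$ (i, q i) \<noteq> 0"
proof -
  obtain q where "q permutes {..<n}" "(\<Prod>i<n. jacobian n D F (c, d) t X $$ (i, q i)) \<noteq> 0"
    using assms unfolding det_jacobian by (auto elim!: sum.not_neutral_contains_not_neutral)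
  then show ?thesis
    by (intro that [of q]) (auto simp: prod_zero_iff)
qed

text \<open>The normalising minimum is subtracted from both vectors and cancels; offsets enter
  validity and the Jacobian only through such differences.\<close>

lemma shift_offsets_diff:
  assumes "shift_offsets n k (c, d) = (c', d')"
  shows "d' j - c' i = d j - c i + int (k i)"
  using assms by (auto simp: shift_offsets_def Let_def)

section \<open>Replacing algebraic equations by a sub-ODE\<close>

lemma C_times_first_derivative:
  assumes "C_times r I f" "1 \<le> r" "open I"
  shows "\<And>t. t \<in> I \<Longrightarrow> (f has_real_derivative deriv f t) (at t)"
    and "continuous_on I f" and "continuous_on I (deriv f)"
proof -
  have *: "(deriv ^^ k) f field_differentiable at t" if "k < r" "t \<in> I" for k t
    using assms that by (auto simp: C_times_def)
  show d: "(f has_real_derivative deriv f t) (at t)" if "t \<in> I" for t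
    using *[of 0 t] that assms(2) by (simp add: field_differentiable_derivI)
  then show "continuous_on I f"
    by (meson DERIV_isCont continuous_at_imp_continuous_on)
  show "continuous_on I (deriv f)"
  \<comment> \<open>\<open>C_times\<close> grants differentiability only below order
    \<open>r\<close>; for \<open>r = 1\<close> continuity of the first derivative is its separate
    last clause.\<close>
  proof (cases "r = 1")
    case True
    then show ?thesis using assms(1) by (simp add: C_times_def)
  next
    case False
    then have "deriv f field_differentiable at t" if "t \<in> I" for t
      using *[of 1 t] that assms(2) by simp
    then show ?thesis
      by (simp add: continuous_at_imp_continuous_on field_differentiable_imp_continuous_at)
  qed
qed

lemma vec_of_cong: "(\<And>k. k < m \<Longrightarrow> y k = z k) \<Longrightarrow> vec_of m y = vec_of m z"
  by (auto simp: vec_of_def)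

text \<open>The setting without offsets. Amenability enters as \<open>D_nonempty\<close>: a solution
  path has a point in \<open>D\<close>.\<close>

locale alias_dae =
  fixes n m u :: nat and p v :: "nat \<Rightarrow> nat" and t0 :: real
    and D :: "(real \<times> jet) set" and F :: eqns
    and g :: "nat \<Rightarrow> real \<Rightarrow> real" and U :: "real set"
    and h :: "nat \<Rightarrow> real \<Rightarrow> (nat \<Rightarrow> real) \<Rightarrow> real" and E :: "(real \<times> (nat \<Rightarrow> real)) set"
  assumes open_D: "open D" and D_nonempty: "D \<noteq> {}"
    and u_less: "u < n" and v_less: "i < m \<Longrightarrow> v i < n"
    and inj_v: "inj_on v {..<m}" and u_notin_v: "u \<notin> v ` {..<m}"
    and p_u: "1 \<le> p u" and p_v: "i < m \<Longrightarrow> 1 \<le> p (v i)"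
    and U: "(t, X) \<in> D \<Longrightarrow> X u 0 \<in> U"
    and E: "(t, X) \<in> D \<Longrightarrow> (X u 0, vec_of m (\<lambda>k. X (v k) 0)) \<in> E"
    and graph_E: "a \<in> U \<Longrightarrow> (a, vec_of m (\<lambda>k. g k a)) \<in> E"
    and first_eqns: "i < m \<Longrightarrow> (t, X) \<in> D \<Longrightarrow> F i t X = X (v i) 0 - g i (X u 0)"
    and g_deriv: "i < m \<Longrightarrow> a \<in> U \<Longrightarrow>
      (g i has_real_derivative h i a (vec_of m (\<lambda>k. g k a))) (at a)"
begin

abbreviation Fode :: eqns where "Fode \<equiv> sub_ode m u v h F"

abbreviation hval :: "nat \<Rightarrow> jet \<Rightarrow> real" where
  "hval i X \<equiv> h i (X u 0) (vec_of m (\<lambda>k. X (v k) 0))"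

text \<open>The \<open>m + 1\<close> variables \<open>u\<close> and \<open>v i\<close> are distinct
  and have numbers below \<open>n\<close>.\<close>

lemma m_less: "m < n"
proof -
  have "card (insert u (v ` {..<m})) \<le> card {..<n}"
    using u_less v_less by (intro card_mono) auto
  then show ?thesis
    using u_notin_v by (simp add: card_image [OF inj_v])
qed

lemma v_neq_u [simp]: "i < m \<Longrightarrow> v i \<noteq> u" "i < m \<Longrightarrow> u \<noteq> v i"
  using u_notin_v by auto

lemma v_eq_iff [simp]: "i < m \<Longrightarrow> k < m \<Longrightarrow> v i = v k \<longleftrightarrow> i = k"
  using inj_v by (auto simp: inj_on_def)

lemma Fode_first: "i < m \<Longrightarrow> Fode i t X = X (v i) 1 - hval i X * X u 1"
  by (simp add: sub_ode_def)

lemma Fode_rest: "\<not> i < m \<Longrightarrow> Fode i = F i"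
  by (simp add: sub_ode_def fun_eq_iff)

lemma sigma_Fode_rest: "\<not> i < m \<Longrightarrow> sigma D Fode i j = sigma D F i j"
  by (simp add: sigma_def Fode_rest)

subsection \<open>Solutions\<close>

lemma jet_of_u: "jet_of n p x t u 0 = x u t" "jet_of n p x t u (Suc 0) = deriv (x u) t"
  using u_less p_u by (auto simp: jet_of_def)

lemma jet_of_v:
  assumes "i < m"
  shows "jet_of n p x t (v i) 0 = x (v i) t" "jet_of n p x t (v i) (Suc 0) = deriv (x (v i)) t"
  using v_less[OF assms] p_v[OF assms] by (auto simp: jet_of_def)

lemma vec_of_jet_of: "vec_of m (\<lambda>k. jet_of n p x t (v k) 0) = vec_of m (\<lambda>k. x (v k) t)"
  by (intro vec_of_cong jet_of_v)

lemma solutions_graph: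
  assumes "(I, x) \<in> solutions n p D t0 F" "t \<in> I" "i < m"
  shows "x (v i) t = g i (x u t)"
proof -
  have "(t, jet_of n p x t) \<in> D" "F i t (jet_of n p x t) = 0"
    using assms m_less by (auto simp: solutions_def)
  then show ?thesis
    using first_eqns[OF \<open>i < m\<close>] by (simp add: jet_of_u jet_of_v assms)
qed

text \<open>Differentiating \<open>v i = g i (u)\<close> yields the sub-ODE because the solution
  stays on the graph of \<open>g\<close>; the built-in initial value is the algebraic equation at
  \<open>t0\<close>.\<close>

lemma solutions_subset_sub_ode: "solutions n p D t0 F \<subseteq> sub_ode_solutions n p D t0 m u v g h F"
proof
  fix Ix assume "Ix \<in> solutions n p D t0 F"
  then obtain I x where Ix: "Ix = (I, x)" and sol: "(I, x) \<in> solutions n p D t0 F"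
    by (cases Ix) auto
  then have I: "open I" "t0 \<in> I" and C: "\<And>j. j < n \<Longrightarrow> C_times (p j) I (x j)"
    and D: "\<And>t. t \<in> I \<Longrightarrow> (t, jet_of n p x t) \<in> D"
    and F: "\<And>t i. t \<in> I \<Longrightarrow> i < n \<Longrightarrow> F i t (jet_of n p x t) = 0"
    by (auto simp: solutions_def)
  have "Fode i t (jet_of n p x t) = 0" if t: "t \<in> I" and i: "i < m" for i t
  proof -
    have "(g i has_real_derivative h i (x u t) (vec_of m (\<lambda>k. g k (x u t)))) (at (x u t))"
      using g_deriv[OF i] U[OF D[OF t]] by (simp add: jet_of_u)
    moreover have "vec_of m (\<lambda>k. g k (x u t)) = vec_of m (\<lambda>k. x (v k) t)"
      using solutions_graph[OF sol t] by (intro vec_of_cong) simp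
    ultimately have "((\<lambda>s. g i (x u s)) has_real_derivative
        h i (x u t) (vec_of m (\<lambda>k. x (v k) t)) * deriv (x u) t) (at t)"
      using C_times_first_derivative(1)[OF C[OF u_less] p_u I(1) t] by (auto intro: DERIV_chain2)
    \<comment> \<open>The algebraic identity is known on \<open>I\<close> only; since
      \<open>I\<close> is open, the derivative still transfers.\<close>
    then have "(x (v i) has_real_derivative
        h i (x u t) (vec_of m (\<lambda>k. x (v k) t)) * deriv (x u) t) (at t)"
      by (rule has_field_derivative_transform_within_open [OF _ I(1) t])
         (simp add: solutions_graph[OF sol _ i])
    then have "deriv (x (v i)) t = h i (x u t) (vec_of m (\<lambda>k. x (v k) t)) * deriv (x u) t"
      by (rule DERIV_imp_deriv)
    then show ?thesis
      using i by (simp add: Fode_first jet_of_u jet_of_v vec_of_jet_of)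
  qed
  then have "Fode i t (jet_of n p x t) = 0" if "t \<in> I" "i < n" for i t
    using F that by (cases "i < m") (auto simp: Fode_rest)
  then show "Ix \<in> sub_ode_solutions n p D t0 m u v g h F"
    using sol Ix solutions_graph[OF sol I(2)]
    by (auto simp: sub_ode_solutions_def solutions_def)
qed

text \<open>Picard-Lindeloef uniqueness: \<open>v\<close> and \<open>g(u)\<close> both solve
  \<open>y' = h(u, y) u'\<close> with the same value at \<open>t0\<close>. As Lipschitz constants
  are local, connectedness of \<open>I\<close> replaces a single global estimate.\<close>

lemma sub_ode_graph:
  assumes lip: "loc_lipschitz m E h"
    and sol: "(I, x) \<in> sub_ode_solutions n p D t0 m u v g h F" and "t \<in> I" "i < m"
  shows "x (v i) t = g i (x u t)"
proof -
  from sol have I: "open I" "is_interval I" "t0 \<in> I"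
    and C: "\<And>j. j < n \<Longrightarrow> C_times (p j) I (x j)"
    and D: "\<And>t. t \<in> I \<Longrightarrow> (t, jet_of n p x t) \<in> D"
    and Fode: "\<And>t i. t \<in> I \<Longrightarrow> i < n \<Longrightarrow> Fode i t (jet_of n p x t) = 0"
    and init: "\<And>i. i < m \<Longrightarrow> x (v i) t0 = g i (x u t0)"
    by (auto simp: sub_ode_solutions_def solutions_def)
  note u_diff = C_times_first_derivative[OF C[OF u_less] p_u I(1)]
  note v_diff = C_times_first_derivative[OF C[OF v_less] p_v I(1)]
  define yv where "yv t = vec_of m (\<lambda>k. x (v k) t)" for t
  define yg where "yg t = vec_of m (\<lambda>k. g k (x u t))" for t
  define z where "z k t = x (v k) t - g k (x u t)" for k t
  define z' where "z' k t = (h k (x u t) (yv t) - h k (x u t) (yg t)) * deriv (x u) t" for k t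
  have xU: "x u t \<in> U" if "t \<in> I" for t
    using U[OF D[OF that]] by (simp add: jet_of_u)
  have g_comp: "((\<lambda>s. g k (x u s)) has_real_derivative h k (x u t) (yg t) * deriv (x u) t) (at t)"
    if "k < m" "t \<in> I" for k t
    unfolding yg_def by (rule DERIV_chain2 [OF g_deriv u_diff(1)]) (use that xU in auto)
  have z: "(z k has_real_derivative z' k t) (at t)" if "k < m" "t \<in> I" for k t
  proof -
    have "deriv (x (v k)) t = h k (x u t) (yv t) * deriv (x u) t"
      using Fode[OF that(2), of k] that m_less
      by (simp add: Fode_first jet_of_u jet_of_v vec_of_jet_of yv_def)
    then show ?thesis
      unfolding z_def z'_def left_diff_distrib
      using DERIV_diff [OF v_diff(1)[OF that(1) that] g_comp[OF that]] by simp
  qed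
  have cont_z: "continuous_on I (z k)" if "k < m" for k
    using z[OF that] by (meson DERIV_isCont continuous_at_imp_continuous_on)
  have cont_v: "continuous_on I (\<lambda>t. (x u t, yv t))"
  proof (intro continuous_on_Pair u_diff(2) continuous_on_coordinatewise_then_product)
    fix k show "continuous_on I (\<lambda>t. yv t k)"
      by (cases "k < m") (simp_all add: yv_def vec_of_def v_diff(2))
  qed
  have cont_g: "continuous_on I (\<lambda>t. (x u t, yg t))"
  proof (intro continuous_on_Pair u_diff(2) continuous_on_coordinatewise_then_product)
    fix k
    have "continuous_on I (\<lambda>t. g k (x u t))" if "k < m"
      using g_comp[OF that] by (meson DERIV_isCont continuous_at_imp_continuous_on)
    then show "continuous_on I (\<lambda>t. yg t k)"
      by (cases "k < m") (simp_all add: yg_def vec_of_def)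
  qed
  define A where "A = {t \<in> I. \<forall>k<m. z k t = 0}"
  have "openin (top_of_set I) A"
  proof -
    have "\<exists>T. open T \<and> a \<in> T \<and> T \<subseteq> A" if "a \<in> A" for a
    proof -
      from that have a: "a \<in> I" "\<And>k. k < m \<Longrightarrow> z k a = 0" by (auto simp: A_def)
      \<comment> \<open>At \<open>a\<close> the curves \<open>yv\<close> and \<open>yg\<close> meet,
        so the Lipschitz neighbourhood of one point contains the other.\<close>
      then have "yg a = yv a"
        unfolding yg_def yv_def z_def by (intro vec_of_cong) simp
      moreover have yE: "(x u t, yv t) \<in> E" "(x u t, yg t) \<in> E" if "t \<in> I" for t
        using E[OF D[OF that]] graph_E[OF xU[OF that]]
        by (simp_all add: jet_of_u vec_of_jet_of yv_def yg_def)
      moreover obtain N L where "open N" "(x u a, yv a) \<in> N"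
        and L: "\<forall>b y z. (b, y) \<in> N \<inter> E \<longrightarrow> (b, z) \<in> N \<inter> E \<longrightarrow>
          (\<forall>i<m. \<bar>h i b y - h i b z\<bar> \<le> L * (\<Sum>k<m. \<bar>y k - z k\<bar>))"
        using bspec [OF lip [unfolded loc_lipschitz_def] yE(1)[OF a(1)]] by (elim exE conjE) (rule that)
      ultimately have N: "open N" "(x u a, yv a) \<in> N" "(x u a, yg a) \<in> N"
        by simp_all
      \<comment> \<open>Near \<open>a\<close> both curves stay in the Lipschitz neighbourhood, and
        the derivative of \<open>x u\<close> stays within 1 of its value at \<open>a\<close>, which
        gives the bound \<open>M\<close>.\<close>
      define J0 where "J0 = (I \<inter> (\<lambda>t. (x u t, yv t)) -` N) \<inter> (I \<inter> (\<lambda>t. (x u t, yg t)) -` N) \<inter>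
        (I \<inter> deriv (x u) -` {deriv (x u) a - 1<..<deriv (x u) a + 1})"
      have "open J0"
        unfolding J0_def
        by (rule open_Int[OF open_Int[OF continuous_open_preimage[OF cont_v I(1) N(1)]
            continuous_open_preimage[OF cont_g I(1) N(1)]]
            continuous_open_preimage[OF u_diff(3) I(1) open_greaterThanLessThan]])
      moreover have "a \<in> J0"
        using a N by (auto simp: J0_def)
      ultimately obtain e where e: "e > 0" "ball a e \<subseteq> J0"
        unfolding open_contains_ball by blast
      define M where "M = \<bar>deriv (x u) a\<bar> + 1"
      have "z k t = 0" if t: "t \<in> ball a e" and "k < m" for k t
      proof (rule linear_growth_zero [where z = z and z' = z' and a = a and J = "ball a e" and K = "\<bar>L\<bar> * M"])
        fix i s assume i: "i < m" and "s \<in> ball a e"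
        then have "s \<in> J0" using e by auto
        then have s: "s \<in> I" "(x u s, yv s) \<in> N \<inter> E" "(x u s, yg s) \<in> N \<inter> E"
          "\<bar>deriv (x u) s\<bar> \<le> M"
          using yE by (auto simp: J0_def M_def)
        show "(z i has_real_derivative z' i s) (at s)"
          by (rule z [OF i s(1)])
        have "(\<Sum>k<m. \<bar>yv s k - yg s k\<bar>) = (\<Sum>k<m. \<bar>z k s\<bar>)"
          by (simp add: yv_def yg_def z_def vec_of_def)
        then have "\<bar>h i (x u s) (yv s) - h i (x u s) (yg s)\<bar> \<le> L * (\<Sum>k<m. \<bar>z k s\<bar>)"
          using L[rule_format, OF s(2,3) i] by simp
        \<comment> \<open>\<open>L\<close> may be negative, whereas the growth constant in
          \<open>linear_growth_zero\<close> has to be nonnegative.\<close>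
        also have "\<dots> \<le> \<bar>L\<bar> * (\<Sum>k<m. \<bar>z k s\<bar>)"
          by (intro mult_right_mono sum_nonneg) auto
        finally have "\<bar>z' i s\<bar> \<le> (\<bar>L\<bar> * (\<Sum>k<m. \<bar>z k s\<bar>)) * M"
          unfolding z'_def abs_mult by (rule mult_mono [OF _ s(4)]) (auto simp: sum_nonneg)
        then show "\<bar>z' i s\<bar> \<le> \<bar>L\<bar> * M * (\<Sum>k<m. \<bar>z k s\<bar>)"
          by (simp add: mult_ac)
      qed (use e a t \<open>k < m\<close> in \<open>auto simp: M_def is_interval_ball_real\<close>)
      then show ?thesis
        using e(1) \<open>ball a e \<subseteq> J0\<close>
        by (intro exI [of _ "ball a e"]) (auto simp: A_def J0_def)
    qed
    then have "open A"
      by (subst open_subopen) blast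
    then show ?thesis
      by (intro open_openin_trans I(1)) (auto simp: A_def)
  qed
  moreover have "closedin (top_of_set I) A"
  proof -
    \<comment> \<open>The outer \<open>I\<close> keeps the formula correct for \<open>m = 0\<close>,
      where the intersection is the whole space.\<close>
    have "A = I \<inter> (\<Inter>k<m. {t \<in> I. z k t = 0})"
      by (auto simp: A_def)
    moreover have "closedin (top_of_set I) (I \<inter> (\<Inter>k<m. {t \<in> I. z k t = 0}))"
    proof (cases "m = 0")
      case False
      then show ?thesis
        by (intro closedin_Int closedin_Inter continuous_closedin_preimage_constant ballI)
           (auto intro: continuous_closedin_preimage_constant cont_z)
    qed simp
    ultimately show ?thesis by simp
  qed
  moreover have "t0 \<in> A"
    using I init by (simp add: A_def z_def)
  ultimately have "A = I"
    using is_interval_connected[OF I(2)] unfolding connected_clopen by blast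
  then show ?thesis
    using \<open>t \<in> I\<close> \<open>i < m\<close> by (auto simp: A_def z_def)
qed

lemma sub_ode_subset_solutions:
  assumes "loc_lipschitz m E h"
  shows "sub_ode_solutions n p D t0 m u v g h F \<subseteq> solutions n p D t0 F"
proof
  fix Ix assume "Ix \<in> sub_ode_solutions n p D t0 m u v g h F"
  then obtain I x where Ix: "Ix = (I, x)"
    and sol: "(I, x) \<in> sub_ode_solutions n p D t0 m u v g h F"
    by (cases Ix) auto
  then have D: "\<And>t. t \<in> I \<Longrightarrow> (t, jet_of n p x t) \<in> D"
    and Fode: "\<And>t i. t \<in> I \<Longrightarrow> i < n \<Longrightarrow> Fode i t (jet_of n p x t) = 0"
    by (auto simp: sub_ode_solutions_def solutions_def)
  have "F i t (jet_of n p x t) = 0" if "t \<in> I" "i < n" for i t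
  proof (cases "i < m")
    case True
    then show ?thesis
      using sub_ode_graph[OF assms sol that(1) True] first_eqns[OF True D[OF that(1)]]
      by (simp add: jet_of_u jet_of_v)
  next
    case False
    then show ?thesis
      using Fode[OF that] by (simp add: Fode_rest)
  qed
  then show "Ix \<in> solutions n p D t0 F"
    using sol Ix by (auto simp: sub_ode_solutions_def solutions_def)
qed

subsection \<open>Signature matrices\<close>

text \<open>On a flat row the new equation reduces to \<open>v i' = 0\<close> on \<open>D\<close>;
  flatness thus decides whether \<open>u\<close> occurs in it.\<close>

definition flat :: "nat \<Rightarrow> bool" where
  "flat i \<longleftrightarrow> (\<forall>(t, X)\<in>D. hval i X = 0)"

lemma hval_upd:
  assumes "k = 0 \<Longrightarrow> j \<noteq> u \<and> j \<notin> v ` {..<m}"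
  shows "hval i (upd X j k s) = hval i X"
proof -
  have "vec_of m (\<lambda>l. upd X j k s (v l) 0) = vec_of m (\<lambda>l. X (v l) 0)"
    using assms by (intro vec_of_cong) (auto simp: upd_apply)
  moreover have "upd X j k s u 0 = X u 0"
    using assms by (auto simp: upd_apply)
  ultimately show ?thesis by simp
qed

lemma occurs_F_first:
  assumes "i < m" "occurs D (F i) j k"
  shows "k = 0 \<and> (j = v i \<or> j = u)"
  using assms by (auto simp: occurs_def first_eqns upd_apply split: if_splits)

text \<open>Changing any other coordinate alters neither \<open>v i'\<close> nor the product of
  \<open>hval i\<close> and \<open>u'\<close>; on a flat row this product is 0 at both jets.\<close>

lemma occurs_Fode_first:
  assumes i: "i < m" and occ: "occurs D (Fode i) j k"
  shows "j = v i \<and> k = 1 \<or> \<not> flat i \<and> (j = u \<and> k \<le> 1 \<or> j \<in> v ` {..<m} \<and> k = 0)"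
proof (rule ccontr)
  assume neg: "\<not> ?thesis"
  obtain t X s where D: "(t, X) \<in> D" "(t, upd X j k s) \<in> D"
    and neq: "Fode i t X \<noteq> Fode i t (upd X j k s)"
    using occ by (auto simp: occurs_def)
  have "upd X j k s (v i) 1 = X (v i) 1"
    using neg by (auto simp: upd_apply)
  moreover have "hval i (upd X j k s) * upd X j k s u 1 = hval i X * X u 1"
  proof (cases "flat i")
    case True
    then have "hval i X = 0" "hval i (upd X j k s) = 0"
      using D by (auto simp: flat_def)
    then show ?thesis by simp
  next
    case False
    then have "hval i (upd X j k s) = hval i X"
      using neg by (intro hval_upd) auto
    moreover have "upd X j k s u 1 = X u 1"
      using False neg by (auto simp: upd_apply)
    ultimately show ?thesis by simp
  qed
  ultimately show False
    using neq i by (simp add: Fode_first)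
qed

lemma sigma_F_v: assumes "i < m" shows "sigma D F i (v i) = 0"
proof -
  obtain t X where X: "(t, X) \<in> D" using D_nonempty by auto
  obtain s where "s \<noteq> X (v i) 0" "(t, upd X (v i) 0 s) \<in> D"
    using upd_neq_in_open [OF open_D X] .
  then have "occurs D (F i) (v i) 0"
    unfolding occurs_def using X assms
    by (intro exI [of _ t] exI [of _ X] exI [of _ s]) (simp add: first_eqns upd_apply)
  then have "sigma D F i (v i) = ereal (real 0)"
    by (rule sigma_eq) (use occurs_F_first[OF assms] in auto)
  then show ?thesis by (simp add: zero_ereal_def)
qed

text \<open>The case distinction is genuine, since \<open>g i\<close> may be constant.\<close>

lemma sigma_F_u: assumes "i < m" shows "sigma D F i u = (if occurs D (F i) u 0 then 0 else -\<infinity>)"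
proof (cases "occurs D (F i) u 0")
  case True
  then have "sigma D F i u = ereal (real 0)"
    by (rule sigma_eq) (use occurs_F_first[OF assms] in auto)
  with True show ?thesis by (simp add: zero_ereal_def)
next
  case False
  then have "\<not> occurs D (F i) u k" for k
    using occurs_F_first[OF assms, of u k] by auto
  with False show ?thesis by (simp add: sigma_eq_minf)
qed

lemma sigma_F_other: "i < m \<Longrightarrow> j \<noteq> v i \<Longrightarrow> j \<noteq> u \<Longrightarrow> sigma D F i j = -\<infinity>"
  using occurs_F_first[of i j] by (intro sigma_eq_minf) auto

lemma sigma_Fode_v: assumes "i < m" shows "sigma D Fode i (v i) = 1"
proof -
  obtain t X where X: "(t, X) \<in> D" using D_nonempty by auto
  obtain s where s: "s \<noteq> X (v i) 1" "(t, upd X (v i) 1 s) \<in> D"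
    using upd_neq_in_open [OF open_D X] .
  have "Fode i t X \<noteq> Fode i t (upd X (v i) 1 s)"
    unfolding Fode_first[OF assms] using s assms by (subst hval_upd) (auto simp: upd_apply)
  then have "occurs D (Fode i) (v i) 1"
    unfolding occurs_def using X s by blast
  then have "sigma D Fode i (v i) = ereal (real 1)"
    by (rule sigma_eq) (use occurs_Fode_first[OF assms] in force)
  then show ?thesis by (simp add: one_ereal_def)
qed

text \<open>Where \<open>hval i X\<close> is nonzero, the equation is affine in \<open>u'\<close>
  with nonzero slope, as \<open>hval\<close> reads only values of order 0.\<close>

lemma sigma_Fode_u: assumes "i < m" shows "sigma D Fode i u = (if flat i then -\<infinity> else 1)"
proof (cases "flat i")
  case True
  then have "\<not> occurs D (Fode i) u k" for k
    using occurs_Fode_first[OF assms, of u k] assms by auto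
  with True show ?thesis by (simp add: sigma_eq_minf)
next
  case False
  then obtain t X where X: "(t, X) \<in> D" "hval i X \<noteq> 0" by (auto simp: flat_def)
  obtain s where s: "s \<noteq> X u 1" "(t, upd X u 1 s) \<in> D"
    using upd_neq_in_open [OF open_D X(1)] .
  have "Fode i t X \<noteq> Fode i t (upd X u 1 s)"
    unfolding Fode_first[OF assms] using s assms X by (subst hval_upd) (auto simp: upd_apply)
  then have "occurs D (Fode i) u 1"
    unfolding occurs_def using X s by blast
  then have "sigma D Fode i u = ereal (real 1)"
    by (rule sigma_eq) (use occurs_Fode_first[OF assms] in force)
  with False show ?thesis by (simp add: one_ereal_def)
qed

text \<open>A foreign \<open>v k\<close> enters only through \<open>h i\<close>, hence
  undifferentiated, and only if the product with \<open>u'\<close> is not identically 0.\<close>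

lemma sigma_Fode_cross:
  assumes "i < m" "k < m" "i \<noteq> k" "sigma D Fode i (v k) \<noteq> -\<infinity>"
  shows "sigma D Fode i (v k) = 0" and "\<not> flat i"
proof -
  obtain l where l: "occurs D (Fode i) (v k) l"
    using assms(4) sigma_eq_minf by blast
  have *: "\<not> flat i \<and> l = 0" if "occurs D (Fode i) (v k) l" for l
    using occurs_Fode_first[OF assms(1) that] assms by auto
  show "\<not> flat i" using *[OF l] by simp
  have "sigma D Fode i (v k) = ereal (real 0)"
    using l by (intro sigma_eq) (use * in auto)
  then show "sigma D Fode i (v k) = 0"
    by (simp add: zero_ereal_def)
qed

lemma sigma_Fode_other:
  "i < m \<Longrightarrow> j \<noteq> u \<Longrightarrow> j \<notin> v ` {..<m} \<Longrightarrow> sigma D Fode i j = -\<infinity>"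
  using occurs_Fode_first[of i j] by (intro sigma_eq_minf) auto

subsection \<open>System Jacobians\<close>

lemma partial_F_v:
  assumes "i < m" "(t, X) \<in> D"
  shows "partial (F i) (v i) 0 t X = 1"
  using assms open_D
  by (intro partial_eqI [of D _ _ _ _ _ "\<lambda>s. s - g i (X u 0)"])
     (auto simp: first_eqns upd_apply intro!: derivative_eq_intros)

text \<open>This is minus \<open>g'\<close>, so \<open>h\<close> is evaluated on the graph above
  \<open>X u 0\<close>; it becomes \<open>- hval i X\<close> once \<open>X\<close> itself lies on
  the graph.\<close>

lemma partial_F_u:
  assumes i: "i < m" and X: "(t, X) \<in> D"
  shows "partial (F i) u 0 t X = - h i (X u 0) (vec_of m (\<lambda>k. g k (X u 0)))"
proof (rule partial_eqI [OF open_D X, where e = "\<lambda>s. X (v i) 0 - g i s"])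
  show "((\<lambda>s. X (v i) 0 - g i s) has_real_derivative
      - h i (X u 0) (vec_of m (\<lambda>k. g k (X u 0)))) (at (X u 0))"
    by (rule derivative_eq_intros g_deriv[OF i] U[OF X] refl)+ simp
qed (use i in \<open>simp add: first_eqns upd_apply\<close>)

lemma partial_Fode_v:
  assumes "i < m" "(t, X) \<in> D"
  shows "partial (Fode i) (v i) 1 t X = 1"
  using assms open_D
  by (intro partial_eqI [of D _ _ _ _ _ "\<lambda>s. s - hval i X * X u 1"])
     (auto simp: Fode_first upd_apply intro!: derivative_eq_intros)

lemma partial_Fode_u:
  assumes "i < m" "(t, X) \<in> D"
  shows "partial (Fode i) u 1 t X = - hval i X"
  using assms open_D
  by (intro partial_eqI [of D _ _ _ _ _ "\<lambda>s. X (v i) 1 - hval i X * s"])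
     (auto simp: Fode_first upd_apply intro!: derivative_eq_intros)

text \<open>The graph hypothesis identifies the coefficient \<open>h(u, v)\<close> of
  \<open>u'\<close> with \<open>g'(u)\<close>, and the covering condition keeps the columns of
  foreign \<open>v k\<close> zero.\<close>

lemma jacobian_sub_ode:
  assumes cross: "cross_terms_covered m v D Fode (c, d)"
    and X: "(t, X) \<in> D" and graph: "\<And>k. k < m \<Longrightarrow> X (v k) 0 = g k (X u 0)"
  shows "jacobian n D Fode (shift_offsets n (\<lambda>i. if i < m then 1 else 0) (c, d)) t X =
    jacobian n D F (c, d) t X"
proof -
  obtain c' d' where shift: "shift_offsets n (\<lambda>i. if i < m then 1 else 0) (c, d) = (c', d')"
    by (cases "shift_offsets n (\<lambda>i. if i < m then 1 else 0) (c, d)")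
  note diff = shift_offsets_diff[OF shift]
  have hval_graph: "hval i X = h i (X u 0) (vec_of m (\<lambda>k. g k (X u 0)))" for i
    using graph vec_of_cong[of m "\<lambda>k. X (v k) 0" "\<lambda>k. g k (X u 0)"] by simp
  have "jacobian n D Fode (c', d') t X $$ (i, j) = jacobian n D F (c, d) t X $$ (i, j)"
    if ij: "i < n" "j < n" for i j
  proof (cases "i < m")
    case False
    then show ?thesis
      using ij diff[of j i] by (simp only: jacobian_index sigma_Fode_rest [OF False]
          Fode_rest [OF False] if_False of_nat_0 add_0_right)
  next
    case i: True
    have d': "d' j - c' i = d j - c i + 1"
      using diff[of j i] i by simp
    consider "j = v i" | "j = u" | k where "k < m" "k \<noteq> i" "j = v k"
      | "j \<noteq> u" "j \<notin> v ` {..<m}"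
      using i by auto
    then show ?thesis
    proof cases
      case 1
      have "jacobian n D F (c, d) t X $$ (i, j) = (if d j - c i = 0 then 1 else 0)"
        using ij i X unfolding jacobian_index[OF ij]
        by (auto simp: 1 sigma_F_v partial_F_v zero_ereal_def simp del: of_int_diff)
      moreover have "jacobian n D Fode (c', d') t X $$ (i, j) = (if d j - c i = 0 then 1 else 0)"
        using ij i X unfolding jacobian_index[OF ij] d'
        using partial_Fode_v[OF i X]
        by (auto simp: 1 sigma_Fode_v one_ereal_def simp del: of_int_diff)
      ultimately show ?thesis by simp
    next
      case 2
      \<comment> \<open>If \<open>u\<close> does not occur in one of the two equations, then the
        corresponding derivative is 0, so the same formula covers that case.\<close>
      have "jacobian n D F (c, d) t X $$ (i, j) = (if d j - c i = 0 then - hval i X else 0)"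
        unfolding jacobian_index[OF ij]
        using partial_F_u[OF i X] partial_eq_0[OF open_D X, of "F i" u 0]
        by (auto simp: 2 sigma_F_u[OF i] hval_graph zero_ereal_def simp del: of_int_diff)
      moreover have "jacobian n D Fode (c', d') t X $$ (i, j) = (if d j - c i = 0 then - hval i X else 0)"
        unfolding jacobian_index[OF ij] d'
        using partial_Fode_u[OF i X] X
        by (auto simp: 2 sigma_Fode_u[OF i] flat_def one_ereal_def simp del: of_int_diff)
      ultimately show ?thesis by simp
    next
      case (3 k)
      have "jacobian n D F (c, d) t X $$ (i, j) = 0"
        unfolding jacobian_index[OF ij] using i 3 by (simp add: sigma_F_other)
      \<comment> \<open>The order is 0 or \<open>-\<infinity>\<close>; in the former case covering
        makes the shifted offset difference at least 1.\<close>
      moreover have "ereal (of_int (d' j - c' i)) \<noteq> sigma D Fode i j"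
      proof (cases "sigma D Fode i j = -\<infinity>")
        case False
        then have "sigma D Fode i j = 0" "c i \<le> d j"
          using sigma_Fode_cross(1)[OF i \<open>k < m\<close>] cross i 3 by (auto simp: cross_terms_covered_def)
        then show ?thesis
          unfolding d' by (simp add: zero_ereal_def)
      qed simp
      ultimately show ?thesis
        by (simp add: jacobian_index[OF ij])
    next
      case 4
      then have "j \<noteq> v i" using i by auto
      with 4 i show ?thesis
        by (simp add: jacobian_index[OF ij] sigma_F_other sigma_Fode_other)
    qed
  qed
  then show ?thesis
    unfolding shift by (intro eq_matI) (auto simp: jacobian_def)
qed

lemma jacobian_sub_ode_solution:
  assumes "cross_terms_covered m v D Fode (c, d)"
    and sol: "(I, x) \<in> solutions n p D t0 F" and t: "t \<in> I"
  shows "jacobian n D Fode (shift_offsets n (\<lambda>i. if i < m then 1 else 0) (c, d)) t (jet_of n p x t) =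
    jacobian n D F (c, d) t (jet_of n p x t)"
proof (rule jacobian_sub_ode [OF assms(1)])
  show "(t, jet_of n p x t) \<in> D"
    using sol t by (auto simp: solutions_def)
qed (simp add: jet_of_u jet_of_v solutions_graph[OF sol t])

subsection \<open>Valid offsets and structural amenability\<close>

lemma valid_first_row:
  assumes "valid_offsets n D F (c, d)" "i < m"
  shows "c i \<le> d (v i)" and "sigma D F i u \<noteq> -\<infinity> \<Longrightarrow> c i \<le> d u"
proof -
  have sig: "sigma D F i j \<le> ereal (of_int (d j - c i))" if "j < n" for j
    using assms that m_less by (auto simp: valid_offsets_iff)
  show "c i \<le> d (v i)"
    using sig[OF v_less[OF assms(2)]] by (simp add: sigma_F_v[OF assms(2)] zero_ereal_def)
  show "c i \<le> d u" if "sigma D F i u \<noteq> -\<infinity>"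
    using sig[OF u_less] that by (simp add: sigma_F_u[OF assms(2)] zero_ereal_def split: if_splits)
qed

text \<open>Row \<open>i\<close> of the transversal of \<open>F\<close> may run through \<open>u\<close> although \<open>u\<close> does not occur in the
  \<open>i\<close>-th equation of \<open>Fode\<close>, namely if \<open>g i\<close> takes different constant values on different
  components of the domain.  A transversal of nonzero entries of the Jacobian avoids this.\<close>

lemma valid_offsets_sub_ode:
  assumes V: "valid_offsets n D F (c, d)"
    and spur: "no_spurious_u m u D F Fode" and cross: "cross_terms_covered m v D Fode (c, d)"
    and sol: "(I, x) \<in> solutions n p D t0 F" "t \<in> I"
    and det: "Determinant.det (jacobian n D F (c, d) t (jet_of n p x t)) \<noteq> 0"
  shows "valid_offsets n D Fode (shift_offsets n (\<lambda>i. if i < m then 1 else 0) (c, d))"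
proof -
  obtain c' d' where shift: "shift_offsets n (\<lambda>i. if i < m then 1 else 0) (c, d) = (c', d')"
    by (cases "shift_offsets n (\<lambda>i. if i < m then 1 else 0) (c, d)")
  note diff = shift_offsets_diff[OF shift]
  have "Determinant.det (jacobian n D Fode (c', d') t (jet_of n p x t)) \<noteq> 0"
    using det jacobian_sub_ode_solution[OF cross sol] by (simp add: shift)
  then obtain q where q: "q permutes {..<n}"
    "\<And>i. i < n \<Longrightarrow> jacobian n D Fode (c', d') t (jet_of n p x t) $$ (i, q i) \<noteq> 0"
    by (rule nonzero_jacobian_transversal) blast
  \<comment> \<open>A nonzero entry can only arise where the offset difference equals the
    order.\<close>
  have "tight n D Fode (c', d') q"
  proof -
    have "ereal (of_int (d' (q i) - c' i)) = sigma D Fode i (q i)" if "i < n" for i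
    proof -
      have "q i < n" using permutes_in_image[OF q(1), of i] that by simp
      then show ?thesis
        using q(2)[OF that] unfolding jacobian_index[OF that \<open>q i < n\<close>] by argo
    qed
    then show ?thesis by (simp add: tight_def)
  qed
  moreover have "sigma D Fode i j \<le> ereal (of_int (d' j - c' i))" if ij: "i < n" "j < n" for i j
  proof (cases "i < m")
    case False
    then have "d' j - c' i = d j - c i"
      using diff[of j i] by simp
    then show ?thesis
      using V ij False by (simp add: valid_offsets_iff sigma_Fode_rest)
  next
    case i: True
    have d': "d' j - c' i = d j - c i + 1"
      using diff[of j i] i by simp
    show ?thesis
    proof (cases "sigma D Fode i j = -\<infinity>")
      case False
      then consider "j = v i" | "j = u" | k where "k < m" "k \<noteq> i" "j = v k"
        using i sigma_Fode_other by blast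
      then show ?thesis
      proof cases
        case 1
        then show ?thesis
          unfolding d' using valid_first_row(1)[OF V i] i by (simp add: sigma_Fode_v one_ereal_def)
      next
        case 2
        \<comment> \<open>Since \<open>u\<close> occurs in the new equation,
          \<open>no_spurious_u\<close> makes it occur in the old one, where validity bounds
          \<open>c i\<close>.\<close>
        then have "c i \<le> d u"
          using valid_first_row(2)[OF V i] spur i False by (auto simp: no_spurious_u_def)
        then show ?thesis
          unfolding d' using i 2 by (simp add: sigma_Fode_u one_ereal_def)
      next
        case (3 k)
        then have "c i \<le> d j"
          using cross i False by (auto simp: cross_terms_covered_def)
        then show ?thesis
          unfolding d' using sigma_Fode_cross(1)[OF i \<open>k < m\<close>] 3 False
          by (simp add: zero_ereal_def)
      qed
    qed simp
  qed
  ultimately show ?thesis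
    using q(1) by (auto simp: shift valid_offsets_iff)
qed

text \<open>A tight transversal matches every row \<open>i < m\<close> to \<open>v i\<close> or to \<open>u\<close>.  Raising \<open>c i\<close> and
  \<open>d (v i)\<close> to at least \<open>d u\<close> preserves tightness in both cases, since a row matched to \<open>u\<close>
  already has \<open>c i = d u\<close>.\<close>

lemma raise_offsets:
  assumes V: "valid_offsets n D F (c, d)" and spur: "no_spurious_u m u D F Fode"
  obtains c' d' where "valid_offsets n D F (c', d')" "cross_terms_covered m v D Fode (c', d')"
proof -
  define c' where "c' i = (if i < m then max (c i) (d u) else c i)" for i
  define d' where "d' j = (if j \<in> v ` {..<m} then max (d j) (d u) else d j)" for j
  have d'u: "d' u = d u" and d'v: "\<And>k. k < m \<Longrightarrow> d' (v k) = max (d (v k)) (d u)"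
    using u_notin_v by (auto simp: d'_def)
  have c'_u: "c' i = d u" if "i < m" "sigma D F i u \<noteq> -\<infinity>" for i
    using valid_first_row(2)[OF V that] that by (simp add: c'_def)
  obtain q where q: "q permutes {..<n}" "tight n D F (c, d) q"
    using V by (auto simp: valid_offsets_iff)
  have q_less: "q i < n" if "i < n" for i
    using permutes_in_image[OF q(1), of i] that by simp
  have tight: "ereal (of_int (d (q i) - c i)) = sigma D F i (q i)" if "i < n" for i
    using q(2) that by (auto simp: tight_def)
  have first: "q i = v i \<and> c i = d (v i) \<or> q i = u \<and> c i = d u" if "i < m" for i
  proof -
    have i: "i < n" using that m_less by simp
    then have fin: "sigma D F i (q i) \<noteq> -\<infinity>"
      using tight[of i] by auto
    then consider "q i = v i" | "q i = u"
      using sigma_F_other[OF \<open>i < m\<close>, of "q i"] by auto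
    then show ?thesis
    proof cases
      case 1
      then show ?thesis
        using tight[OF i] by (simp add: sigma_F_v[OF that] zero_ereal_def)
    next
      case 2
      then show ?thesis
        using tight[OF i] fin by (simp add: sigma_F_u[OF that] zero_ereal_def split: if_splits)
    qed
  qed
  have "d' (q i) - c' i = d (q i) - c i" if i: "i < n" for i
  proof (cases "i < m")
    case True
    then show ?thesis
      using first[OF True] d'u d'v[OF True] by (auto simp: c'_def)
  next
    case False
    have "d' (q i) = d (q i)"
    proof (cases "q i \<in> v ` {..<m}")
      case True
      then obtain k where k: "k < m" "q i = v k" by auto
      \<comment> \<open>Row \<open>i\<close> has taken column \<open>v k\<close>, so row
        \<open>k\<close> must be matched to \<open>u\<close>. Then
        \<open>d u = c k \<le> d (v k)\<close>, and the maximum changes nothing.\<close>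
      then have "q k \<noteq> v k"
        using False permutes_inj[OF q(1)] by (metis injD)
      then have "c k = d u" using first[OF k(1)] by auto
      then show ?thesis
        using valid_first_row(1)[OF V k(1)] by (simp add: k d'v)
    qed (simp add: d'_def)
    then show ?thesis using False by (simp add: c'_def)
  qed
  then have "tight n D F (c', d') q"
    using tight by (simp add: tight_def del: of_int_diff)
  moreover have "sigma D F i j \<le> ereal (of_int (d' j - c' i))" if ij: "i < n" "j < n" for i j
  proof (cases "i < m")
    case False
    have "sigma D F i j \<le> ereal (of_int (d j - c i))"
      using V ij by (auto simp: valid_offsets_iff)
    \<comment> \<open>In these rows \<open>c\<close> is unchanged while \<open>d\<close> can only
      grow.\<close>
    also have "\<dots> \<le> ereal (of_int (d' j - c' i))"
      using False by (auto simp: c'_def d'_def)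
    finally show ?thesis .
  next
    case i: True
    show ?thesis
    proof (cases "sigma D F i j = -\<infinity>")
      case False
      then consider "j = v i" | "j = u"
        using i sigma_F_other by blast
      then show ?thesis
      proof cases
        case 1
        then show ?thesis
          using valid_first_row(1)[OF V i] i d'v[OF i]
          by (simp add: sigma_F_v zero_ereal_def c'_def)
      next
        case 2
        then show ?thesis
          using c'_u[OF i] False d'u i by (auto simp: sigma_F_u zero_ereal_def)
      qed
    qed simp
  qed
  ultimately have "valid_offsets n D F (c', d')"
    using q(1) by (auto simp: valid_offsets_iff)
  moreover have "cross_terms_covered m v D Fode (c', d')"
    unfolding cross_terms_covered_def prod.case
  proof (intro allI impI)
    fix i k assume ik: "i < m" "k < m" "i \<noteq> k" and "sigma D Fode i (v k) \<noteq> -\<infinity>"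
    \<comment> \<open>A cross term forces a row that is not flat, so \<open>u\<close> occurs in the
      new equation and hence in the old one. Then \<open>c' i = d u\<close>, the level to which
      \<open>d' (v k)\<close> was raised.\<close>
    then have "\<not> flat i" by (rule sigma_Fode_cross(2))
    then have "sigma D F i u \<noteq> -\<infinity>"
      using spur ik(1) by (simp add: no_spurious_u_def sigma_Fode_u)
    then show "c' i \<le> d' (v k)"
      using c'_u[OF ik(1)] d'v[OF ik(2)] by simp
  qed
  ultimately show ?thesis by (rule that)
qed

end

section \<open>Solution sets, Jacobians and amenability combined\<close>

theorem theorem3p6:
  fixes n m u :: nat and p v :: "nat \<Rightarrow> nat" and t0 :: real
    and D :: "(real \<times> jet) set" and F Fbar :: eqns
    and c d :: "nat \<Rightarrow> int"
    and g :: "nat \<Rightarrow> real \<Rightarrow> real" and U :: "real set"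
    and h :: "nat \<Rightarrow> real \<Rightarrow> (nat \<Rightarrow> real) \<Rightarrow> real" and E :: "(real \<times> (nat \<Rightarrow> real)) set"
  assumes dae: "is_dae n p D F"
    and amenable: "structurally_amenable n p D F (solutions n p D t0 F)"
    and valid: "valid_offsets n D F (c, d)"
    and m: "m \<ge> 1"
    and aliases: "u < n" "\<forall>i<m. v i < n" "inj_on v {..<m}" "u \<notin> v ` {..<m}"
    and orders: "p u \<ge> 1" "\<forall>i<m. p (v i) \<ge> 1"
    and domains: "\<forall>(t, X)\<in>D. X u 0 \<in> U \<and> (X u 0, vec_of m (\<lambda>k. X (v k) 0)) \<in> E"
                 "\<forall>a\<in>U. (a, vec_of m (\<lambda>k. g k a)) \<in> E"
    and first_eqns: "\<forall>i<m. \<forall>(t, X)\<in>D. F i t X = X (v i) 0 - g i (X u 0)"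
    and g_deriv: "\<forall>i<m. \<forall>a\<in>U. (g i has_real_derivative h i a (vec_of m (\<lambda>k. g k a))) (at a)"
    and Fbar: "Fbar = sub_ode m u v h F"
  shows
    "solutions n p D t0 F \<subseteq> sub_ode_solutions n p D t0 m u v g h F
     \<and> (loc_lipschitz m E h \<longrightarrow>
          sub_ode_solutions n p D t0 m u v g h F \<subseteq> solutions n p D t0 F)
     \<and> (cross_terms_covered m v D Fbar (c, d) \<longrightarrow>
          (\<forall>(I, x)\<in>solutions n p D t0 F. \<forall>t\<in>I.
             jacobian n D Fbar (shift_offsets n (\<lambda>i. if i < m then 1 else 0) (c, d)) t (jet_of n p x t)
             = jacobian n D F (c, d) t (jet_of n p x t)))
     \<and> (no_spurious_u m u D F Fbar \<longrightarrow>
          (cross_terms_covered m v D Fbar (c, d) \<longrightarrow>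
             valid_offsets n D Fbar (shift_offsets n (\<lambda>i. if i < m then 1 else 0) (c, d)))
          \<and> structurally_amenable n p D Fbar (sub_ode_solutions n p D t0 m u v g h F))"
proof -
  have D: "open D" using dae by (simp add: is_dae_def)
  obtain c0 d0 I0 x0 s where V0: "valid_offsets n D F (c0, d0)"
    and sol0: "(I0, x0) \<in> solutions n p D t0 F" "s \<in> I0"
    and "Determinant.det (jacobian n D F (c0, d0) s (jet_of n p x0 s)) \<noteq> 0"
    using amenable by (auto simp: structurally_amenable_def)
  \<comment> \<open>Amenability provides nonsingularity for some valid offsets; invariance of the
    determinant carries it to \<open>(c, d)\<close> and to the raised offsets.\<close>
  then have det: "Determinant.det (jacobian n D F (c1, d1) s (jet_of n p x0 s)) \<noteq> 0"
    if "valid_offsets n D F (c1, d1)" for c1 d1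
    using det_jacobian_cong_offsets[OF that V0] by simp
  have "D \<noteq> {}"
    using sol0 by (auto simp: solutions_def)
  then interpret alias_dae n m u p v t0 D F g U h E
    using D aliases orders domains first_eqns g_deriv by unfold_locales auto
  have amenable_Fbar: "structurally_amenable n p D Fbar (sub_ode_solutions n p D t0 m u v g h F)"
    if spur: "no_spurious_u m u D F Fbar"
  proof -
    \<comment> \<open>The given \<open>(c, d)\<close> may leave cross terms uncovered, so
      amenability is witnessed by the raised offsets.\<close>
    obtain c1 d1 where V1: "valid_offsets n D F (c1, d1)"
      and cross: "cross_terms_covered m v D Fbar (c1, d1)"
      using raise_offsets[OF valid] spur unfolding Fbar by blast
    have "valid_offsets n D Fbar (shift_offsets n (\<lambda>i. if i < m then 1 else 0) (c1, d1))"
      using valid_offsets_sub_ode[OF V1 _ _ sol0 det[OF V1]] spur cross by (simp add: Fbar)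
    moreover have "Determinant.det (jacobian n D Fbar
        (shift_offsets n (\<lambda>i. if i < m then 1 else 0) (c1, d1)) s (jet_of n p x0 s)) \<noteq> 0"
      using jacobian_sub_ode_solution[OF _ sol0] cross det[OF V1] by (simp add: Fbar)
    moreover have "(I0, x0) \<in> sub_ode_solutions n p D t0 m u v g h F"
      using solutions_subset_sub_ode sol0(1) by blast
    ultimately show ?thesis
      using sol0(2) unfolding structurally_amenable_def by blast
  qed
  show ?thesis
    using solutions_subset_sub_ode sub_ode_subset_solutions amenable_Fbar
      jacobian_sub_ode_solution[of c d] valid_offsets_sub_ode[OF valid _ _ sol0 det[OF valid]]
    unfolding Fbar by blast
qed

end
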